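(* Let $g\ge4$ be even and let $p_1,\dots,p_r$ be distinct odd primes, each relatively prime to $g$. For each $i$ let $j_i\ge0$ be the largest integer such that $p_i^{j_i}$ divides $\operatorname{lcm}(o_g(p_1),\dots,o_g(p_r))$. Assume that $p_1^{\iota_g(p_1)+j_1}p_2^{\iota_g(p_2)+j_2}\cdots p_r^{\iota_g(p_r)+j_r}$ is complete. Then $p_1^{k_1}\cdots p_r^{k_r}$ is complete for all integers $k_1,\dots,k_r\ge0$.
   Context: For an odd integer $m\ge1$, an extreme cycle for the digit set $\{0,m\}$ (with respect to the even integer $g\ge4$) is a finite set of distinct integers $\{x_0,\dots,x_{r-1}\}$ together with digits $l_0,\dots,l_{r-1}\in\{0,m\}$ such that $x_{j+1}=(x_j+l_j)/g$ for $0\le j\le r-2$ and $x_0=(x_{r-1}+l_{r-1})/g$. The cycle $\{0\}$ is the trivial extreme cycle. $m$ is complete if the only extreme cycle for $\{0,m\}$ is the trivial one. For $m$ coprime to $g$, $o_g(m)$ denotes the order of $g$ in $U(\mathbb{Z}_m)$. For an odd prime $p$ coprime to $g$, $\iota_g(p)$ denotes the largest integer $l\ge1$ such that $o_g(p^l)=o_g(p)$. *)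

theory Defs
  imports "HOL-Number_Theory.Number_Theory"
begin

text \<open>
  The digits are not recorded: they are determined by the cycle points, as
  \<open>l j = g * x (j + 1) - x j\<close> with indices read cyclically. The division is the exact one of
  \<^typ>\<open>rat\<close>; \<open>div\<close> on \<^typ>\<open>int\<close> would truncate.
\<close>

definition extreme_cycle :: "nat \<Rightarrow> nat \<Rightarrow> int set \<Rightarrow> bool" where
  "extreme_cycle g m C \<longleftrightarrow>
     (\<exists>(r::nat) (x :: nat \<Rightarrow> int) (l :: nat \<Rightarrow> int).
        r \<ge> 1 \<and> inj_on x {..<r} \<and> C = x ` {..<r} \<and>
        (\<forall>j<r. l j \<in> {0, int m}) \<and>
        (\<forall>j. j + 1 < r \<longrightarrow>
           (of_int (x (j + 1)) :: rat) = (of_int (x j) + of_int (l j)) / of_nat g) \<and>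
        (of_int (x 0) :: rat) = (of_int (x (r - 1)) + of_int (l (r - 1))) / of_nat g)"

definition complete_number :: "nat \<Rightarrow> nat \<Rightarrow> bool" where
  "complete_number g m \<longleftrightarrow> {C. extreme_cycle g m C} = {{0}}"

text \<open>
  Here \<open>ord n g\<close> is the order of \<open>g\<close> modulo \<open>n\<close> (modulus first). For \<open>g \<ge> 2\<close> and a prime \<open>p\<close>
  coprime to \<open>g\<close> the maximum exists: the exponents \<open>l\<close> in question satisfy
  \<open>p ^ l dvd g ^ ord p g - 1\<close>, and that number is positive.
\<close>

definition iota :: "nat \<Rightarrow> nat \<Rightarrow> nat" where
  "iota g p = (GREATEST l. l \<ge> 1 \<and> ord (p ^ l) g = ord p g)"

end

theory Submission
  imports Defs
begin

text \<open>
  The points of an extreme cycle \<open>C\<close> lie in \<open>[0, m / (g - 1)]\<close>, hence in \<open>[0, m / 3]\<close>, and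
  walking the cycle backwards shows that \<open>C\<close> is closed modulo \<open>m\<close> under multiplication by \<open>g\<close>.

  Suppose \<open>m = p q\<close> with \<open>p\<close> an odd prime dividing \<open>q\<close>, and that some power \<open>g ^ n\<close> is \<open>1\<close>
  modulo \<open>q\<close> but not modulo \<open>m\<close>. Multiplying by powers of \<open>g ^ n\<close> translates every \<open>y \<in> C\<close>
  prime to \<open>p\<close> by \<open>q\<close> modulo \<open>m\<close>, within \<open>C\<close>; as \<open>q \<le> m / 3\<close>, no wrap-around can occur, so
  there is no largest such \<open>y\<close>. Hence \<open>p\<close> divides all of \<open>C\<close>, and dividing by \<open>p\<close> gives an
  extreme cycle for \<open>q\<close>. So \<open>m\<close> is complete if \<open>q\<close> is.

  Lifting the exponent provides such an \<open>n\<close> for \<open>p = p\<^sub>i\<close> as soon as \<open>k\<^sub>i\<close> exceeds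
  \<open>\<iota>\<^sub>g(p\<^sub>i) + j\<^sub>i\<close>, so all exponents can be lowered to those bounds; and divisors of complete
  numbers are complete.
\<close>

section \<open>Integer form, scaling, and completeness of divisors\<close>

lemma extreme_cycle_int_iff:
  assumes "g > 0"
  shows "extreme_cycle g m C \<longleftrightarrow>
     (\<exists>(r::nat) x l. r \<ge> 1 \<and> inj_on x {..<r} \<and> C = x ` {..<r} \<and>
        (\<forall>j<r. l j \<in> {0, int m}) \<and>
        (\<forall>j. j + 1 < r \<longrightarrow> int g * x (j + 1) = x j + l j) \<and>
        int g * x 0 = x (r - 1) + l (r - 1))"
proof -
  have "(of_int a = (of_int b + of_int c) / (of_nat g :: rat)) \<longleftrightarrow> int g * a = b + c" for a b c :: int
  proof -
    have "(of_int a = (of_int b + of_int c) / (of_nat g :: rat)) \<longleftrightarrow>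
        (of_int (int g * a) :: rat) = of_int (b + c)"
      using assms by (simp add: field_simps)
    also have "\<dots> \<longleftrightarrow> int g * a = b + c"
      by (rule of_int_eq_iff)
    finally show ?thesis .
  qed
  then show ?thesis
    unfolding extreme_cycle_def by simp
qed

text \<open>The cycle equations are linear and homogeneous in points and digits together. One
  direction carries cycles up from a divisor of a complete number; the other divides out a common
  factor of all points.\<close>

lemma extreme_cycle_scale:
  assumes "g > 0" "d > 0"
  shows "extreme_cycle g (d * m) ((*) (int d) ` C) \<longleftrightarrow> extreme_cycle g m C"
proof
  assume "extreme_cycle g m C"
  then obtain r :: nat and x l where *: "r \<ge> 1" "inj_on x {..<r}" "C = x ` {..<r}"
    "\<forall>j<r. l j \<in> {0, int m}"
    "\<forall>j. j + 1 < r \<longrightarrow> int g * x (j + 1) = x j + l j" "int g * x 0 = x (r - 1) + l (r - 1)"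
    unfolding extreme_cycle_int_iff[OF assms(1)] by blast
  have scale: "int g * (int d * a) = int d * b + int d * c" if "int g * a = b + c" for a b c
  proof -
    have "int g * (int d * a) = int d * (int g * a)"
      by simp
    also have "\<dots> = int d * b + int d * c"
      unfolding that by (rule distrib_left)
    finally show ?thesis .
  qed
  show "extreme_cycle g (d * m) ((*) (int d) ` C)"
    unfolding extreme_cycle_int_iff[OF assms(1)]
  proof (rule exI[of _ r], rule exI[of _ "\<lambda>i. int d * x i"],
      rule exI[of _ "\<lambda>i. int d * l i"], intro conjI allI impI)
    show "inj_on (\<lambda>i. int d * x i) {..<r}"
      using *(2) assms(2) by (auto simp: inj_on_def)
    show "(*) (int d) ` C = (\<lambda>i. int d * x i) ` {..<r}"
      unfolding *(3) image_image ..
    show "int d * l j \<in> {0, int (d * m)}" if "j < r" for j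
      using *(4)[rule_format, OF that] by auto
    show "int g * (int d * x (j + 1)) = int d * x j + int d * l j" if "j + 1 < r" for j
      using *(5) that by (intro scale) simp
    show "int g * (int d * x 0) = int d * x (r - 1) + int d * l (r - 1)"
      using *(6) by (rule scale)
  qed (fact *(1))
next
  assume "extreme_cycle g (d * m) ((*) (int d) ` C)"
  then obtain r :: nat and x l where *: "r \<ge> 1" "inj_on x {..<r}" "(*) (int d) ` C = x ` {..<r}"
    "\<forall>j<r. l j \<in> {0, int (d * m)}"
    "\<forall>j. j + 1 < r \<longrightarrow> int g * x (j + 1) = x j + l j" "int g * x 0 = x (r - 1) + l (r - 1)"
    unfolding extreme_cycle_int_iff[OF assms(1)] by blast
  \<comment> \<open>For indices below \<open>r\<close> both divisions are exact: the points lie in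
    the image of multiplication by \<open>d\<close>, and the digits are \<open>0\<close> or
    \<open>d * m\<close>.\<close>
  define y where "y i = x i div int d" for i
  define k where "k i = l i div int d" for i
  have x: "x i = int d * y i" if "i < r" for i
  proof -
    have "x i \<in> (*) (int d) ` C"
      unfolding *(3) using that by simp
    then show ?thesis
      using assms(2) by (auto simp: y_def)
  qed
  have l: "l i = int d * k i" "k i \<in> {0, int m}" if "i < r" for i
    using *(4)[rule_format, OF that] assms(2) by (auto simp: k_def)
  have cancel: "int g * a = b + c" if "int g * (int d * a) = int d * b + int d * c" for a b c
  proof -
    have "int d * (int g * a) = int d * (b + c)"
      using that by (simp add: algebra_simps)
    then show ?thesis
      using assms(2) by simp
  qed
  have r: "0 < r" "r - 1 < r"
    using *(1) by auto
  show "extreme_cycle g m C"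
    unfolding extreme_cycle_int_iff[OF assms(1)]
  proof (rule exI[of _ r], rule exI[of _ y], rule exI[of _ k], intro conjI allI impI)
    show "inj_on y {..<r}"
      using *(2) x by (auto simp: inj_on_def)
    have "(*) (int d) ` C = (*) (int d) ` (y ` {..<r})"
      unfolding *(3) image_image using x by (intro image_cong) auto
    then show "C = y ` {..<r}"
      using assms(2) by (subst (asm) inj_image_eq_iff) (auto simp: inj_on_def)
    show "k j \<in> {0, int m}" if "j < r" for j
      using l that by blast
    show "int g * y (j + 1) = y j + k j" if "j + 1 < r" for j
      using *(5)[rule_format, OF that] unfolding x[OF that] x[OF add_lessD1[OF that]] l(1)[OF add_lessD1[OF that]]
      by (rule cancel)
    show "int g * y 0 = y (r - 1) + k (r - 1)"
      using *(6) unfolding x[OF r(1)] x[OF r(2)] l(1)[OF r(2)]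
      by (rule cancel)
  qed (fact *(1))
qed

lemma extreme_cycle_zero:
  assumes "g > 0"
  shows "extreme_cycle g m {0}"
  unfolding extreme_cycle_int_iff[OF assms]
  by (intro exI[of _ "1::nat"] exI[of _ "\<lambda>_. 0::int"]) (auto simp: inj_on_def)

lemma complete_number_iff:
  assumes "g > 0"
  shows "complete_number g m \<longleftrightarrow> (\<forall>C. extreme_cycle g m C \<longrightarrow> C = {0})"
  unfolding complete_number_def using extreme_cycle_zero[OF assms, of m] by auto

text \<open>Multiplying a nontrivial cycle for \<open>n\<close> by \<open>m / n\<close> would give a
  nontrivial cycle for \<open>m\<close>.\<close>

lemma complete_number_dvd:
  assumes "g > 0" "complete_number g m" "n dvd m" "m > 0"
  shows "complete_number g n"
  unfolding complete_number_iff[OF assms(1)]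
proof (intro allI impI)
  fix C assume C: "extreme_cycle g n C"
  obtain d where d: "m = d * n"
    using assms(3) by (auto simp: dvd_def mult.commute)
  with assms(4) have "d > 0"
    by auto
  then have "(*) (int d) ` C = {0}"
    using C assms(1,2) d extreme_cycle_scale[of g d n C] complete_number_iff by auto
  then have "(*) (int d) ` C = (*) (int d) ` {0}"
    by simp
  then show "C = {0}"
    using \<open>d > 0\<close> by (subst (asm) inj_image_eq_iff) (auto simp: inj_on_def)
qed

section \<open>Size of the cycle points and closure under multiplication by \<open>g\<close>\<close>

text \<open>This frees later arguments from the indexing and its wrap-around. Modulo
  \<open>m\<close> the digit vanishes, so \<open>z\<close> represents \<open>g * y\<close>.\<close>

lemma extreme_cycle_predecessor:
  assumes "g > 0" "extreme_cycle g m C" "y \<in> C"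
  shows "\<exists>z\<in>C. \<exists>l\<in>{0, int m}. int g * y = z + l"
proof -
  obtain r :: nat and x l where *: "r \<ge> 1" "C = x ` {..<r}"
    "\<forall>j<r. l j \<in> {0, int m}"
    "\<forall>j. j + 1 < r \<longrightarrow> int g * x (j + 1) = x j + l j" "int g * x 0 = x (r - 1) + l (r - 1)"
    using assms(2) unfolding extreme_cycle_int_iff[OF assms(1)] by blast
  obtain i where i: "i < r" "y = x i"
    using assms(3) *(2) by auto
  show ?thesis
  proof (cases i)
    case 0
    then show ?thesis
      using i * by (intro bexI[of _ "x (r - 1)"] bexI[of _ "l (r - 1)"]) auto
  next
    case (Suc j)
    then show ?thesis
      using i * by (intro bexI[of _ "x j"] bexI[of _ "l j"]) auto
  qed
qed

lemma extreme_cycle_finite_nonempty: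
  assumes "extreme_cycle g m C"
  shows "finite C" "C \<noteq> {}"
  using assms unfolding extreme_cycle_def by (auto simp: lessThan_empty_iff)

text \<open>Apply the predecessor equation at the extremes: \<open>g * Min C\<close> is at least
  \<open>Min C\<close>, and \<open>g * Max C\<close> is at most \<open>Max C + m\<close>.\<close>

lemma extreme_cycle_bounds:
  assumes "g > 1" "extreme_cycle g m C" "y \<in> C"
  shows "0 \<le> y" "(int g - 1) * y \<le> int m"
proof -
  note fin = extreme_cycle_finite_nonempty[OF assms(2)]
  have g0: "g > 0"
    using assms(1) by simp
  have g: "int g - 1 > 0"
    using assms(1) by simp
  obtain z l where "z \<in> C" "l \<in> {0, int m}" "int g * Min C = z + l"
    using extreme_cycle_predecessor[OF g0 assms(2) Min_in[OF fin]] by blast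
  moreover have "Min C \<le> z"
    using fin \<open>z \<in> C\<close> by simp
  ultimately have "(int g - 1) * Min C \<ge> 0"
    by (auto simp: algebra_simps)
  then have "Min C \<ge> 0"
    using g by (simp add: zero_le_mult_iff)
  then show "0 \<le> y"
    using fin assms(3) by (meson Min_le order_trans)
  obtain z l where "z \<in> C" "l \<in> {0, int m}" "int g * Max C = z + l"
    using extreme_cycle_predecessor[OF g0 assms(2) Max_in[OF fin]] by blast
  moreover have "z \<le> Max C"
    using fin \<open>z \<in> C\<close> by simp
  ultimately have "(int g - 1) * Max C \<le> int m"
    by (auto simp: algebra_simps)
  moreover have "(int g - 1) * y \<le> (int g - 1) * Max C"
    using fin assms(3) g by (intro mult_left_mono) auto
  ultimately show "(int g - 1) * y \<le> int m"
    by linarith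
qed

lemma extreme_cycle_closed_power:
  assumes "g > 0" "extreme_cycle g m C" "y \<in> C"
  shows "\<exists>z\<in>C. [z = int g ^ n * y] (mod int m)"
proof (induction n)
  case 0
  show ?case
    using assms(3) by (intro bexI[of _ y]) auto
next
  case (Suc n)
  then obtain z where z: "z \<in> C" "[z = int g ^ n * y] (mod int m)"
    by auto
  obtain w l where w: "w \<in> C" "l \<in> {0, int m}" "int g * z = w + l"
    using extreme_cycle_predecessor[OF assms(1,2) z(1)] by blast
  have "[w = int g * z] (mod int m)"
    using w(2,3) by (auto simp: cong_def)
  also have "[int g * z = int g * (int g ^ n * y)] (mod int m)"
    using z(2) by (rule cong_scalar_left)
  finally show ?case
    using w(1) by (auto simp: mult.assoc)
qed

section \<open>Multiplying the modulus by a prime it already contains\<close>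

text \<open>In the binomial expansion every term of degree at least 2 in \<open>b\<close> vanishes
  modulo \<open>m\<close>.\<close>

lemma power_one_plus_square_zero_cong:
  fixes b m :: int
  assumes "m dvd b * b"
  shows "[(1 + b) ^ s = 1 + int s * b] (mod m)"
proof (induction s)
  case (Suc s)
  have "[(1 + b) ^ Suc s = (1 + b) * (1 + int s * b)] (mod m)"
    using cong_scalar_left[OF Suc] by simp
  also have "(1 + b) * (1 + int s * b) = 1 + int (Suc s) * b + int s * (b * b)"
    by (simp add: algebra_simps)
  also have "[\<dots> = 1 + int (Suc s) * b] (mod m)"
    using assms by (simp add: cong_iff_dvd_diff)
  finally show ?case .
qed simp

lemma complete_number_prime_mult:
  assumes g: "g \<ge> 4" and p: "prime p" "odd p"
    and q: "p dvd q" "q > 0" "complete_number g q"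
    and n: "[int g ^ n = 1] (mod int q)" "\<not> [int g ^ n = 1] (mod int (p * q))"
  shows "complete_number g (p * q)"
proof -
  have g0: "g > 0" "g > 1"
    using g by auto
  have pi: "prime (int p)"
    using p(1) by simp
  have "p \<noteq> 2"
    using p(2) by auto
  then have p3: "p \<ge> 3"
    using prime_ge_2_nat[OF p(1)] by linarith
  show ?thesis
    unfolding complete_number_iff[OF g0(1)]
  proof (intro allI impI, rule ccontr)
    fix C assume C: "extreme_cycle g (p * q) C" and "C \<noteq> {0}"
    define C' where "C' = {y \<in> C. \<not> int p dvd y}"
    have "C' \<noteq> {}"
    proof
      assume "C' = {}"
      then have "\<forall>y\<in>C. int p * (y div int p) = y"
        by (auto simp: C'_def)
      then have "(*) (int p) ` (\<lambda>y. y div int p) ` C = C"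
        by (simp add: image_image)
      then obtain D where D: "C = (*) (int p) ` D"
        by metis
      then have "extreme_cycle g q D"
        using C extreme_cycle_scale[of g p q D] g0 p3 by simp
      then have "D = {0}"
        using q(3) complete_number_iff[OF g0(1)] by blast
      with D \<open>C \<noteq> {0}\<close> show False
        by simp
    qed
    moreover have "finite C'"
      using extreme_cycle_finite_nonempty(1)[OF C] by (simp add: C'_def)
    ultimately have "Max C' \<in> C'"
      by simp
    then obtain y where y: "y \<in> C" "\<not> int p dvd y" "y = Max C'"
      by (auto simp: C'_def)
    \<comment> \<open>Multiplication by \<open>g ^ n\<close> sends \<open>y\<close> to
      \<open>y + t * y * q\<close>. The second hypothesis on \<open>n\<close> makes \<open>t\<close>
      prime to \<open>p\<close>, so \<open>t * y\<close> has an inverse \<open>u\<close> modulo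
      \<open>p\<close>; repeating the multiplication \<open>s\<close> times, with \<open>s\<close>
      the residue of \<open>u\<close>, makes the shift exactly \<open>q\<close> modulo
      \<open>p * q\<close>.\<close>
    obtain t where t: "int g ^ n = 1 + t * int q"
      using n(1) by (metis cong_iff_lin cong_sym mult.commute)
    have "\<not> int p dvd t"
    proof
      assume "int p dvd t"
      then have "int (p * q) dvd int g ^ n - 1"
        by (simp add: t mult_dvd_mono)
      with n(2) show False
        by (simp add: cong_iff_dvd_diff)
    qed
    then have "coprime (t * y) (int p)"
      using y(2) pi by (metis coprime_commute prime_dvd_mult_iff prime_imp_coprime)
    then obtain u where "[t * y * u = 1] (mod int p)"
      using cong_solve_coprime_int by blast
    define s where "s = nat (u mod int p)"
    have s: "int s = u mod int p"
      using p3 by (simp add: s_def)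
    have "[t * y * int s = 1] (mod int p)"
      using \<open>[t * y * u = 1] (mod int p)\<close> by (simp add: s cong_def mod_simps)
    then have styq: "int (p * q) dvd int s * (t * int q) * y - int q"
      using mult_dvd_mono[of "int p" "t * y * int s - 1" "int q" "int q"]
      by (simp add: cong_iff_dvd_diff algebra_simps)
    \<comment> \<open>Here \<open>p dvd q\<close> is essential: it makes \<open>q * q\<close> vanish
      modulo \<open>p * q\<close>, so powers of \<open>1 + t * q\<close> are linear in the
      exponent.\<close>
    have sq: "int (p * q) dvd (t * int q) * (t * int q)"
    proof -
      have "int p * int q dvd int q * int q"
        using q(1) by (intro mult_dvd_mono) auto
      then have "int p * int q dvd int q * int q * (t * t)"
        by (rule dvd_mult2)
      then show ?thesis
        by (simp add: ac_simps)
    qed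
    obtain z where z: "z \<in> C" "[z = int g ^ (n * s) * y] (mod int (p * q))"
      using extreme_cycle_closed_power[OF g0(1) C y(1)] by blast
    have "[int g ^ (n * s) * y = (1 + int s * (t * int q)) * y] (mod int (p * q))"
      unfolding power_mult t
      by (intro cong_scalar_right power_one_plus_square_zero_cong sq)
    also have "[(1 + int s * (t * int q)) * y = y + int q] (mod int (p * q))"
      using styq by (simp add: cong_iff_dvd_diff algebra_simps)
    finally have zy: "[z = y + int q] (mod int (p * q))"
      using z(2) cong_trans by blast
    have third: "0 \<le> w \<and> 3 * w \<le> int (p * q)" if "w \<in> C" for w
    proof -
      have "0 \<le> w" "(int g - 1) * w \<le> int (p * q)"
        using extreme_cycle_bounds[OF g0(2) C that] by auto
      moreover have "3 * w \<le> (int g - 1) * w"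
        using g \<open>0 \<le> w\<close> by (intro mult_right_mono) auto
      ultimately show ?thesis
        by linarith
    qed
    have "3 * int q \<le> int (p * q)"
      using mult_right_mono[of 3 "int p" "int q"] p3 by simp
    moreover have "int q > 0"
      using q(2) by simp
    \<comment> \<open>Both sides lie in \<open>[0, p * q)\<close>, since \<open>y\<close> and
      \<open>q\<close> are each at most a third of \<open>p * q\<close>; so the congruence is an
      equality.\<close>
    ultimately have "z = y + int q"
      using third[OF z(1)] third[OF y(1)] zy
      by (intro cong_less_imp_eq_int[of z "int (p * q)" "y + int q"]) linarith+
    moreover have "\<not> int p dvd y + int q"
      using q(1) y(2) by (simp add: dvd_add_left_iff)
    ultimately have "z \<in> C'"
      using z(1) by (simp add: C'_def)
    then have "z \<le> y"
      using \<open>finite C'\<close> y(3) by simp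
    with \<open>z = y + int q\<close> q(2) show False
      by simp
  qed
qed

section \<open>Lifting the exponent\<close>

text \<open>The cofactor of \<open>a - 1\<close> in \<open>a ^ c - 1\<close> is a sum of
  \<open>c\<close> powers of \<open>a\<close>, each \<open>1\<close> modulo \<open>p\<close>; hence
  it is congruent to \<open>c\<close> and prime to \<open>p\<close>.\<close>

lemma multiplicity_power_diff_one_coprime:
  fixes p a :: int
  assumes "prime p" "p dvd a - 1" "a > 1" "\<not> p dvd int c"
  shows "multiplicity p (a ^ c - 1) = multiplicity p (a - 1)"
proof -
  have "[a = 1] (mod p)"
    using assms(2) by (simp add: cong_iff_dvd_diff)
  then have "[a ^ i = 1] (mod p)" for i
    using cong_pow[of a 1 p i] by simp
  then have "[(\<Sum>i<c. a ^ i) = (\<Sum>i<c. 1)] (mod p)"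
    by (intro cong_sum) auto
  then have "\<not> p dvd (\<Sum>i<c. a ^ i)"
    using assms(4) by (simp add: cong_dvd_iff)
  then have "multiplicity p (\<Sum>i<c. a ^ i) = 0" "(\<Sum>i<c. a ^ i) \<noteq> 0"
    by (auto simp: not_dvd_imp_multiplicity_0)
  moreover have "a ^ c - 1 = (a - 1) * (\<Sum>i<c. a ^ i)"
    by (rule power_diff_1_eq)
  ultimately show ?thesis
    using assms(1,3) by (simp only:) (subst prime_elem_multiplicity_mult_distrib, auto)
qed

text \<open>The cofactor \<open>S\<close> is congruent to \<open>p\<close> modulo
  \<open>p * p\<close>, so it contains \<open>p\<close> exactly once. The correction is
  \<open>b * p * ((p - 1) div 2)\<close>, where oddness makes the half exact and \<open>b\<close>
  supplies the second factor \<open>p\<close>.\<close>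

lemma multiplicity_power_diff_one_prime:
  fixes a :: int
  assumes p: "prime p" "odd p" "int p dvd a - 1" "a > 1"
  shows "multiplicity (int p) (a ^ p - 1) = Suc (multiplicity (int p) (a - 1))"
proof -
  define b where "b = a - 1"
  have a: "a = 1 + b"
    by (simp add: b_def)
  have pb: "int p dvd b" 
    using p(3) by (simp add: b_def)
  have pi: "prime (int p)" "int p > 1"
    using p(1) prime_gt_1_nat[OF p(1)] by auto
  define S where "S = (\<Sum>i<p. a ^ i)"
  have "[S = (\<Sum>i<p. 1 + int i * b)] (mod (int p * int p))"
    unfolding S_def a using pb
    by (intro cong_sum power_one_plus_square_zero_cong mult_dvd_mono)
  also have "(\<Sum>i<p. 1 + int i * b) = int p + b * (\<Sum>i<p. int i)"
    by (simp add: sum.distrib sum_distrib_left mult.commute)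
  also have "(\<Sum>i<p. int i) = int p * ((int p - 1) div 2)"
  proof -
    have "2 * (\<Sum>i<p. int i) = int p * (int p - 1)"
      by (induction p) (auto simp: algebra_simps)
    moreover have "2 * ((int p - 1) div 2) = int p - 1"
      using p(2) by simp
    ultimately have "2 * (\<Sum>i<p. int i) = 2 * (int p * ((int p - 1) div 2))"
      by (metis mult.left_commute)
    then show ?thesis
      by simp
  qed
  also have "[int p + b * (int p * ((int p - 1) div 2)) = int p] (mod (int p * int p))"
  proof -
    have "int p * int p dvd b * int p * ((int p - 1) div 2)"
      using pb by (intro dvd_mult2 mult_dvd_mono) auto
    then show ?thesis
      by (simp add: cong_iff_dvd_diff mult.assoc)
  qed
  finally obtain t where "S = int p * (1 + int p * t)"
    by (metis cong_iff_lin cong_sym distrib_left mult.assoc mult.right_neutral)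
  moreover have "\<not> int p dvd 1 + int p * t"
    using pi by (simp add: dvd_add_left_iff)
  ultimately have "multiplicity (int p) S = 1" "S \<noteq> 0"
    using pi by (auto intro!: multiplicity_eqI)
  moreover have "a ^ p - 1 = (a - 1) * S"
    unfolding S_def by (rule power_diff_1_eq)
  ultimately show ?thesis
    using p(4) pi by (simp add: prime_elem_multiplicity_mult_distrib)
qed

lemma multiplicity_power_diff_one:
  fixes a :: int
  assumes p: "prime p" "odd p" "int p dvd a - 1" "a > 1" and "\<not> p dvd c"
  shows "multiplicity (int p) (a ^ (c * p ^ e) - 1) = multiplicity (int p) (a - 1) + e"
proof (induction e)
  case 0
  show ?case
    using multiplicity_power_diff_one_coprime[of "int p" a c] assms by simp
next
  case (Suc e)
  have "c * p ^ e > 0"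
    using assms(5) p(1) by (metis dvd_0_right mult_pos_pos not_gr0 prime_gt_0_nat zero_less_power)
  then have "a ^ (c * p ^ e) > 1"
    using p(4) by simp
  moreover have "[a ^ (c * p ^ e) = 1 ^ (c * p ^ e)] (mod int p)"
    using p(3) by (intro cong_pow) (simp add: cong_iff_dvd_diff)
  then have "int p dvd a ^ (c * p ^ e) - 1"
    by (simp add: cong_iff_dvd_diff)
  ultimately show ?case
    using multiplicity_power_diff_one_prime[OF p(1,2), of "a ^ (c * p ^ e)"] Suc
    by (simp add: power_mult[symmetric] ac_simps)
qed

section \<open>Orders modulo prime powers\<close>

text \<open>For \<open>l \<ge> 1\<close> the order modulo \<open>p\<close> always divides the order
  modulo \<open>p ^ l\<close>. They agree exactly when \<open>p ^ l\<close> divides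
  \<open>g ^ ord p g - 1\<close>, so the admissible \<open>l\<close> run from 1 to the multiplicity
  and \<open>GREATEST\<close> is attained.\<close>

lemma iota_eq_multiplicity:
  assumes "prime p" "coprime p g" "g > 1"
  shows "iota g p = multiplicity (int p) (int g ^ ord p g - 1)" "iota g p \<ge> 1"
proof -
  define e where "e = multiplicity (int p) (int g ^ ord p g - 1)"
  have "ord p g > 0"
    using assms(2) by simp
  then have gt: "int g ^ ord p g > 1"
    using assms(3) by simp
  have dvd_iff: "int p ^ l dvd int g ^ d - 1 \<longleftrightarrow> ord (p ^ l) g dvd d" for l d
    unfolding ord_divides[symmetric] cong_int_iff[symmetric] cong_iff_dvd_diff by simp
  have dvd_iff_le: "int p ^ l dvd int g ^ ord p g - 1 \<longleftrightarrow> l \<le> e" for l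
    using gt assms(1) unfolding e_def
    by (subst power_dvd_iff_le_multiplicity) (auto simp: not_prime_unit)
  have mono: "ord p g dvd ord (p ^ l) g" if "l \<ge> 1" for l
  proof -
    have "int p ^ 1 dvd int p ^ l"
      using that by (rule le_imp_power_dvd)
    then show ?thesis
      using dvd_iff[of l "ord (p ^ l) g"] dvd_iff[of 1 "ord (p ^ l) g"] by auto
  qed
  have eq_iff: "ord (p ^ l) g = ord p g \<longleftrightarrow> l \<le> e" if "l \<ge> 1" for l
    using dvd_iff[of l "ord p g"] dvd_iff_le[of l] mono[OF that] by (metis dvd_antisym dvd_refl)
  have "e \<ge> 1"
    using dvd_iff[of 1 "ord p g"] dvd_iff_le[of 1] by simp
  then have "iota g p = e"
    unfolding iota_def using eq_iff by (intro Greatest_equality) auto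
  with \<open>e \<ge> 1\<close> show "iota g p = multiplicity (int p) (int g ^ ord p g - 1)" "iota g p \<ge> 1"
    by (auto simp: e_def)
qed

text \<open>Raising to the power \<open>p\<close> gains a factor \<open>p\<close> in the modulus.
  The induction starts from the congruence modulo \<open>p\<close>, hence proves the exponent
  \<open>Suc k\<close>; the weaker \<open>k\<close> suffices for the primes other than
  \<open>p\<^sub>i\<close>.\<close>

lemma power_cong_one_prime_power:
  assumes "ord p g * p ^ k dvd n"
  shows "[int g ^ n = 1] (mod (int p ^ k))"
proof -
  have *: "[int g ^ (ord p g * p ^ k) = 1] (mod (int p ^ Suc k))"
  proof (induction k)
    case 0
    have "[g ^ ord p g = 1] (mod p)"
      by (rule ord)
    then show ?case
      unfolding cong_int_iff[symmetric] by simp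
  next
    case (Suc k)
    define a where "a = int g ^ (ord p g * p ^ k)"
    obtain b where b: "a = 1 + int p ^ Suc k * b"
      using Suc unfolding a_def by (metis cong_iff_lin cong_sym)
    have "int p ^ Suc (Suc k) dvd (int p ^ Suc k * b) * (int p ^ Suc k * b)"
    proof -
      have "int p ^ Suc (Suc k) dvd int p ^ (Suc k + Suc k)"
        by (intro le_imp_power_dvd) auto
      then have "int p ^ Suc (Suc k) dvd int p ^ (Suc k + Suc k) * (b * b)"
        by (rule dvd_mult2)
      then show ?thesis
        by (simp add: power_add ac_simps)
    qed
    then have "[a ^ p = 1 + int p * (int p ^ Suc k * b)] (mod (int p ^ Suc (Suc k)))"
      unfolding b by (rule power_one_plus_square_zero_cong)
    also have "[1 + int p * (int p ^ Suc k * b) = 1] (mod (int p ^ Suc (Suc k)))"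
      by (simp add: cong_iff_dvd_diff)
    finally show ?case
      by (simp add: a_def power_mult[symmetric] ac_simps)
  qed
  obtain d where "n = ord p g * p ^ k * d"
    using assms by blast
  then have "[int g ^ n = 1] (mod (int p ^ Suc k))"
    using cong_pow[OF *, of d] by (simp add: power_mult)
  then show ?thesis
    by (rule cong_dvd_modulus) simp
qed

section \<open>Descent on the exponents\<close>

theorem theorem2p26:
  fixes g r :: nat and p j :: "nat \<Rightarrow> nat"
  assumes "g \<ge> 4" and "even g"
    and "inj_on p {1..r}"
    and "\<And>i. i \<in> {1..r} \<Longrightarrow> prime (p i)"
    and "\<And>i. i \<in> {1..r} \<Longrightarrow> odd (p i)"
    and "\<And>i. i \<in> {1..r} \<Longrightarrow> coprime (p i) g"
    and "\<And>i. i \<in> {1..r} \<Longrightarrow> j i = multiplicity (p i) (LCM i'\<in>{1..r}. ord (p i') g)"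
    and "complete_number g (\<Prod>i=1..r. p i ^ (iota g (p i) + j i))"
  shows "\<forall>k :: nat \<Rightarrow> nat. complete_number g (\<Prod>i=1..r. p i ^ k i)"
proof
  fix k :: "nat \<Rightarrow> nat"
  define I where "I = {1..r}"
  have fin: "finite I"
    by (simp add: I_def)
  note inj = assms(3)[folded I_def] and prime = assms(4)[folded I_def] and odd = assms(5)[folded I_def]
    and coprime = assms(6)[folded I_def]
  define L where "L = (LCM i\<in>I. ord (p i) g)"
  have jL: "j i = multiplicity (p i) L" if "i \<in> I" for i
    using assms(7) that by (simp add: L_def I_def)
  have ord_L: "ord (p i) g dvd L" if "i \<in> I" for i
    unfolding L_def using that by (intro dvd_Lcm) auto
  have "0 \<notin> (\<lambda>i. ord (p i) g) ` I"
    using coprime by (force simp: ord_eq_0)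
  then have "L \<noteq> 0"
    unfolding L_def using fin by (subst Lcm_0_iff) auto
  show "complete_number g (\<Prod>i=1..r. p i ^ k i)"
    unfolding I_def[symmetric]
  proof (induction "sum k I" arbitrary: k rule: less_induct)
    case less
    show ?case
    proof (cases "\<forall>i\<in>I. k i \<le> iota g (p i) + j i")
      case True
      have "(\<Prod>i\<in>I. p i ^ k i) dvd (\<Prod>i\<in>I. p i ^ (iota g (p i) + j i))"
        using True by (intro prod_dvd_prod le_imp_power_dvd) auto
      moreover have "(\<Prod>i\<in>I. p i ^ (iota g (p i) + j i)) > 0"
        using prime by (intro prod_pos) (auto simp: prime_gt_0_nat)
      ultimately show ?thesis
        using assms(1) by (intro complete_number_dvd[OF _ assms(8)[folded I_def]]) auto
    next
      case False
      then obtain i where i: "i \<in> I" and "k i > iota g (p i) + j i"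
        by force
      \<comment> \<open>The number \<open>h = k i - 1\<close> is the exponent after lowering by one,
        and \<open>e\<close> is its excess over the bound.\<close>
      then obtain e where e: "k i = Suc (iota g (p i) + (j i + e))"
        by (metis add.assoc less_iff_Suc_add)
      define P where "P = (\<Prod>l\<in>I - {i}. p l ^ k l)"
      define h where "h = iota g (p i) + (j i + e)"
      define q where "q = p i ^ h * P"
      note pi = prime[OF i] odd[OF i] coprime[OF i]
      have iota: "iota g (p i) = multiplicity (int (p i)) (int g ^ ord (p i) g - 1)" "iota g (p i) \<ge> 1"
        using iota_eq_multiplicity[OF pi(1,3)] assms(1) by auto
      have split: "(\<Prod>l\<in>I. p l ^ k l) = p i * q"
        using fin i e by (simp add: prod.remove[of I i] P_def q_def h_def)
      have ne: "p l \<noteq> p i" if "l \<in> I - {i}" for l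
        using inj_onD[OF inj] i that by blast
      have "coprime (p i) P"
        unfolding P_def
      proof (rule prod_coprime_right)
        fix l assume l: "l \<in> I - {i}"
        then have "coprime (p i) (p l)"
          using prime i ne[OF l] by (intro primes_coprime) auto
        then show "coprime (p i) (p l ^ k l)"
          by simp
      qed
      have "P > 0"
        unfolding P_def using prime by (intro prod_pos) (auto simp: prime_gt_0_nat)
      have "complete_number g (\<Prod>l\<in>I. p l ^ (k(i := h)) l)"
        using fin i e by (intro less) (auto simp: sum.remove[of I i] h_def)
      moreover have "(\<Prod>l\<in>I. p l ^ (k(i := h)) l) = q"
        using fin i by (simp add: prod.remove[of I i] P_def q_def)
      ultimately have "complete_number g q"
        by simp
      obtain L' where L': "L = p i ^ j i * L'" "\<not> p i dvd L'"
        using multiplicity_decompose'[of L "p i"] \<open>L \<noteq> 0\<close> pi(1) jL[OF i] by (metis not_prime_unit)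
      \<comment> \<open>The order divides \<open>p i - 1\<close>, so it survives the removal of all
        factors \<open>p i\<close> from \<open>L\<close>.\<close>
      have "coprime (ord (p i) g) (p i ^ j i)"
      proof -
        have "ord (p i) g dvd p i - 1"
          using order_divides_totient[of "p i" g] pi(1,3) by (simp add: totient_prime)
        moreover have "coprime (p i - 1) (p i)"
          using prime_gt_0_nat[OF pi(1)] by (rule coprime_diff_one_left_nat)
        ultimately show ?thesis
          by (meson coprime_divisors coprime_power_right_iff dvd_refl)
      qed
      then have "ord (p i) g dvd L'"
        using ord_L[OF i] L'(1) by (simp add: coprime_dvd_mult_right_iff)
      then obtain c where c: "L' = ord (p i) g * c"
        by blast
      txt \<open>
        With \<open>p\<^sub>i ^ j\<^sub>i\<close> removed from \<open>L\<close>, the exponent of \<open>p\<^sub>i\<close> in \<open>g ^ n - 1\<close> can be tuned to be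
        exactly \<open>h = k\<^sub>i - 1\<close>, while the factor \<open>P\<close> takes care of the other primes.
      \<close>
      define n where "n = L' * P * p i ^ (j i + e)"
      \<comment> \<open>In this form \<open>n\<close> is visibly a multiple of every
        \<open>ord (p l) g\<close>. Keeping \<open>L\<close> as a factor costs
        \<open>p i ^ j i\<close>, which is where the threshold gets its summand
        \<open>j i\<close>.\<close>
      have n: "n = L * (P * p i ^ e)"
        by (simp add: n_def L'(1) power_add)
      have mult: "multiplicity (int (p i)) (int g ^ n - 1) = h"
      proof -
        \<comment> \<open>Only the factor \<open>p i ^ (j i + e)\<close> of the exponent over the
          order now raises the multiplicity, from \<open>iota g (p i)\<close> to
          \<open>h\<close>.\<close>
        have "\<not> p i dvd c * P"
          using L'(2) c pi(1) \<open>coprime (p i) P\<close>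
          by (metis coprime_absorb_left dvd_mult not_prime_unit prime_dvd_mult_iff)
        moreover have "int (p i) dvd int g ^ ord (p i) g - 1"
          using iota by (metis multiplicity_dvd' power_one_right)
        moreover have "int g ^ ord (p i) g > 1"
          using assms(1) pi(3) by simp
        moreover have "n = ord (p i) g * (c * P * p i ^ (j i + e))"
          by (simp add: n_def c)
        ultimately show ?thesis
          using multiplicity_power_diff_one[OF pi(1,2), of "int g ^ ord (p i) g" "c * P" "j i + e"] iota
          by (simp add: power_mult h_def)
      qed
      have "int (p i) ^ h dvd int g ^ n - 1"
        using mult by (intro multiplicity_dvd') simp
      moreover have "int P dvd int g ^ n - 1"
      proof -
        have "int (p l) ^ k l dvd int g ^ n - 1" if "l \<in> I - {i}" for l
        proof -
          have "p l ^ k l dvd P"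
            unfolding P_def using that fin by (intro dvd_prodI) auto
          then have "ord (p l) g * p l ^ k l dvd n"
            unfolding n using ord_L[of l] that by (intro mult_dvd_mono dvd_mult2) auto
          then show ?thesis
            using power_cong_one_prime_power cong_iff_dvd_diff by blast
        qed
        moreover have "coprime (int (p l) ^ k l) (int (p l') ^ k l')"
          if "l \<in> I - {i}" "l' \<in> I - {i}" "l \<noteq> l'" for l l'
        proof -
          have "p l \<noteq> p l'"
            using inj_onD[OF inj] that by blast
          then show ?thesis
            using that prime by (simp add: primes_coprime)
        qed
        ultimately have "[int g ^ n = 1] (mod (\<Prod>l\<in>I - {i}. int (p l) ^ k l))"
          by (intro cong_cong_prod_coprime) (auto simp: cong_iff_dvd_diff)
        then show ?thesis
          by (simp add: P_def cong_iff_dvd_diff)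
      qed
      moreover have "coprime (int (p i) ^ h) (int P)"
        using \<open>coprime (p i) P\<close> by simp
      ultimately have "int q dvd int g ^ n - 1"
        unfolding q_def by (simp add: divides_mult)
      moreover have "\<not> int (p i * q) dvd int g ^ n - 1"
      proof
        assume "int (p i * q) dvd int g ^ n - 1"
        then have "int (p i) ^ Suc h dvd int g ^ n - 1"
          by (rule dvd_trans[rotated]) (simp add: q_def)
        \<comment> \<open>Excludes \<open>g ^ n - 1 = 0\<close>, which every power of
          \<open>p i\<close> divides although its \<open>multiplicity\<close> is 0 by
          convention.\<close>
        moreover have "n > 0"
          using \<open>L \<noteq> 0\<close> \<open>P > 0\<close> pi(1) by (simp add: n prime_gt_0_nat)
        then have "int g ^ n > 1"
          using assms(1) by (intro one_less_power) auto
        then have "int g ^ n - 1 \<noteq> 0"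
          by simp
        ultimately have "Suc h \<le> multiplicity (int (p i)) (int g ^ n - 1)"
          using pi(1) by (intro multiplicity_geI) (auto simp: not_prime_unit)
        with mult show False
          by simp
      qed
      \<comment> \<open>After lowering, the exponent \<open>h\<close> is still at least
        \<open>iota g (p i) \<ge> 1\<close>.\<close>
      moreover have "p i dvd q"
        using iota(2) by (simp add: q_def h_def dvd_mult2 dvd_power)
      moreover have "q > 0"
        using \<open>P > 0\<close> pi(1) by (simp add: q_def prime_gt_0_nat)
      ultimately show ?thesis
        unfolding split using assms(1) pi \<open>complete_number g q\<close>
        by (intro complete_number_prime_mult[where n = n]) (auto simp: cong_iff_dvd_diff)
    qed
  qed
qed

end
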